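(* Let $G$ be a finite group, $p$ a prime dividing $|G|$, and $P$ a Sylow $p$-subgroup of $G$. If \[ \left( \prod_{x \in P} \lambda_G(x) \right)^{1/|P|} \leq n_p(G)^{\frac{1}{p}}, \] then \[ \frac{|\mathfrak{U}_p(G)|}{|P|} \geq n_p(G)^{1-\frac{1}{p}}. \]
   Context: For a finite group $G$ and a prime $p$, $n_p(G)$ is the number of Sylow $p$-subgroups of $G$, and $\mathfrak{U}_p(G)=\bigcup_{P\in Syl_p(G)}P$ is the set of $p$-elements of $G$ (elements whose order is a power of $p$, including the identity). For a $p$-element $x\in G$, $\lambda_G(x)$ is the number of Sylow $p$-subgroups of $G$ containing $x$. *)

theory Defs
  imports Complex_Main "HOL-Algebra.Sylow"
begin

definition sylow_subgroups :: "('a, 'b) monoid_scheme \<Rightarrow> nat \<Rightarrow> 'a set set" where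
  "sylow_subgroups G p = {P. subgroup P G \<and> card P = p ^ multiplicity p (order G)}"

definition num_sylow :: "('a, 'b) monoid_scheme \<Rightarrow> nat \<Rightarrow> nat" where
  "num_sylow G p = card (sylow_subgroups G p)"

definition p_elements :: "('a, 'b) monoid_scheme \<Rightarrow> nat \<Rightarrow> 'a set" where
  "p_elements G p = (\<Union>P \<in> sylow_subgroups G p. P)"

definition sylow_count :: "('a, 'b) monoid_scheme \<Rightarrow> nat \<Rightarrow> 'a \<Rightarrow> nat" where
  "sylow_count G p x = card {P \<in> sylow_subgroups G p. x \<in> P}"

end

theory Submission
  imports Defs "HOL-Algebra.Group_Action" "HOL-Analysis.Convex"
begin

text \<open>
  Each \<open>p\<close>-element \<open>x\<close> lies in exactly \<open>\<lambda>(x)\<close> Sylow \<open>p\<close>-subgroups, so giving \<open>x\<close> the weight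
  \<open>1/\<lambda>(x)\<close> in each of them counts it once in total:
  \<open>|U\<^sub>p(G)| = (\<Sum>Q. \<Sum>x\<in>Q. 1/\<lambda>(x))\<close>, with \<open>Q\<close> ranging over the Sylow subgroups
  (\<open>card_p_elements_eq_weights\<close>). Conjugation permutes the Sylow subgroups, hence preserves \<open>\<lambda>\<close>,
  and all Sylow subgroups are conjugate (\<open>sylow_conjugate\<close>). The inner sum is therefore the same
  for every \<open>Q\<close>, and \<open>|U\<^sub>p(G)| = n\<^sub>p(G) (\<Sum>x\<in>P. 1/\<lambda>(x))\<close>
  (\<open>card_p_elements_eq_num_sylow_mult\<close>). Dividing by \<open>|P|\<close> turns the sum into the arithmetic mean
  of the numbers \<open>1/\<lambda>(x)\<close>. It is at least their geometric mean, the reciprocal of the geometric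
  mean of \<open>\<lambda>\<close> over \<open>P\<close>, which by hypothesis is at least \<open>n\<^sub>p(G)\<close> to the power \<open>-1/p\<close>.

  Conjugacy comes from the usual fixed point argument: \<open>P\<close> acts on the cosets of \<open>Q\<close>, whose
  number is prime to \<open>p\<close>, while nontrivial orbits of a \<open>p\<close>-group have size divisible by \<open>p\<close>.
  A fixed coset \<open>Q a\<close> yields \<open>a P a\<inverse> \<subseteq> Q\<close>.
\<close>

section \<open>Fixed points of p-groups\<close>

lemma (in group_action) prime_power_fixed_point:
  assumes "prime p" and ord: "order G = p ^ k"
    and fin: "finite E" and ndvd: "\<not> p dvd card E"
  obtains x where "x \<in> E" "\<And>g. g \<in> carrier G \<Longrightarrow> \<phi> g x = x"
proof -
  have "card E = (\<Sum>orb\<in>orbits G E \<phi>. card orb)"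
    using disjoint_sum[OF fin, of "\<lambda>_. 1::nat"] by simp
  then obtain orb where orb: "orb \<in> orbits G E \<phi>" "\<not> p dvd card orb"
    using ndvd dvd_sum[of "orbits G E \<phi>" p card] by auto
  then obtain x where x: "x \<in> E" "orb = orbit G \<phi> x"
    unfolding orbits_def by auto
  have "card orb dvd p ^ k"
    using orbit_stabilizer_theorem[OF x(1)] x(2) ord by (metis dvd_triv_left)
  then obtain i where i: "card orb = p ^ i"
    using divides_primepow_nat[OF \<open>prime p\<close>] by blast
  with orb(2) have "i = 0"
    by (cases i) auto
  with i have "card orb = 1" by simp
  then obtain y where y: "orb = {y}"
    by (meson card_1_singletonE)
  then have "orbit G \<phi> x = {x}"
    using orbit_refl[OF x(1)] x(2) by auto
  then have "\<phi> g x = x" if "g \<in> carrier G" for g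
    using that unfolding orbit_def by auto
  with x(1) show ?thesis using that by blast
qed

context group
begin

text \<open>
  Right cosets force the inverse: \<open>g\<close> has to act by right multiplication with \<open>g\<inverse>\<close> for this to be
  a left action.
\<close>
lemma coset_action:
  assumes H: "subgroup H G"
  shows "group_action G (rcosets H) (\<lambda>g. \<lambda>R\<in>rcosets H. R #> inv g)"
proof -
  let ?E = "rcosets H" and ?\<phi> = "\<lambda>g. \<lambda>R\<in>rcosets H. R #> inv g"
  have sub: "R \<subseteq> carrier G" if "R \<in> ?E" for R
    using subgroup.rcosets_carrier[OF H is_group that] .
  have mem: "R #> g \<in> ?E" if R: "R \<in> ?E" and g: "g \<in> carrier G" for R g
  proof -
    obtain a where a: "a \<in> carrier G" "R = H #> a"
      using R unfolding RCOSETS_def by auto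
    then have "R #> g = H #> (a \<otimes> g)"
      using coset_mult_assoc[OF subgroup.subset[OF H] a(1) g] by simp
    then show ?thesis
      using rcosetsI[OF subgroup.subset[OF H]] a g by auto
  qed
  have bij: "?\<phi> g \<in> Bij ?E" if g: "g \<in> carrier G" for g
  proof -
    have "bij_betw (?\<phi> g) ?E ?E"
    proof (rule bij_betw_byWitness[where f' = "\<lambda>R. R #> g"])
      show "\<forall>R\<in>?E. ?\<phi> g R #> g = R"
        using g by (auto simp: coset_mult_assoc sub)
      show "\<forall>R\<in>?E. ?\<phi> g (R #> g) = R"
        using g by (auto simp: coset_mult_assoc sub mem)
    qed (use g in \<open>auto simp: mem\<close>)
    then show ?thesis
      unfolding Bij_def by auto
  qed
  have "?\<phi> (g \<otimes> h) = compose ?E (?\<phi> g) (?\<phi> h)" if gh: "g \<in> carrier G" "h \<in> carrier G" for g h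
  proof
    fix R
    show "?\<phi> (g \<otimes> h) R = compose ?E (?\<phi> g) (?\<phi> h) R"
    proof (cases "R \<in> ?E")
      case True
      then show ?thesis
        using gh by (simp add: compose_def mem sub inv_mult_group coset_mult_assoc)
    qed (simp add: compose_def)
  qed
  then have "?\<phi> \<in> hom G (BijGroup ?E)"
    using bij by (intro homI) (auto simp: BijGroup_def)
  then show ?thesis
    unfolding group_action_def group_hom_def group_hom_axioms_def
    using is_group group_BijGroup by blast
qed

section \<open>Conjugacy of Sylow subgroups\<close>

abbreviation conjugate :: "'a \<Rightarrow> 'a \<Rightarrow> 'a" where
  "conjugate a x \<equiv> a \<otimes> x \<otimes> inv a"

lemma conjugate_inv_conjugate:
  assumes "a \<in> carrier G" "x \<in> carrier G"
  shows "conjugate a (conjugate (inv a) x) = x" "conjugate (inv a) (conjugate a x) = x"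
  using conjugation_is_surj[of a x] conjugation_is_surj[of "inv a" x] assms by simp_all

lemma conjugate_image_inv_image:
  assumes a: "a \<in> carrier G" and "X \<subseteq> carrier G"
  shows "conjugate a ` (conjugate (inv a) ` X) = X" "conjugate (inv a) ` (conjugate a ` X) = X"
proof -
  have X: "x \<in> carrier G" if "x \<in> X" for x using that assms by auto
  have "(\<lambda>x. conjugate a (conjugate (inv a) x)) ` X = (\<lambda>x. x) ` X"
    by (intro image_cong refl conjugate_inv_conjugate(1) a X)
  then show "conjugate a ` (conjugate (inv a) ` X) = X"
    by (simp only: image_image image_ident)
  have "(\<lambda>x. conjugate (inv a) (conjugate a x)) ` X = (\<lambda>x. x) ` X"
    by (intro image_cong refl conjugate_inv_conjugate(2) a X)
  then show "conjugate (inv a) ` (conjugate a ` X) = X"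
    by (simp only: image_image image_ident)
qed

lemma inj_on_conjugate:
  assumes "a \<in> carrier G"
  shows "inj_on (conjugate a) (carrier G)"
  using assms conjugation_is_inj by (intro inj_onI) blast

lemma sylow_subgroup_subset: "Q \<in> sylow_subgroups G p \<Longrightarrow> Q \<subseteq> carrier G"
  unfolding sylow_subgroups_def by (auto dest: subgroup.subset)

lemma conjugate_image_sylow:
  assumes a: "a \<in> carrier G" and Q: "Q \<in> sylow_subgroups G p"
  shows "conjugate a ` Q \<in> sylow_subgroups G p"
proof -
  have "conjugate a \<in> hom G G"
  proof (rule homI)
    fix x y assume xy: "x \<in> carrier G" "y \<in> carrier G"
    have "inv a \<otimes> (a \<otimes> (y \<otimes> inv a)) = y \<otimes> inv a"
      using a xy by (simp add: m_assoc [symmetric])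
    then show "conjugate a (x \<otimes> y) = conjugate a x \<otimes> conjugate a y"
      using a xy by (simp add: m_assoc)
  qed (use a in simp)
  then interpret group_hom G G "conjugate a"
    by unfold_locales
  have "card (conjugate a ` Q) = card Q"
    using inj_on_subset[OF inj_on_conjugate[OF a] sylow_subgroup_subset[OF Q]] card_image by blast
  then show ?thesis
    using Q subgroup_img_is_subgroup unfolding sylow_subgroups_def by simp
qed

text \<open>
  Some coset \<open>Q a\<close> is fixed by all of \<open>P\<close>, which says \<open>a P a\<inverse> \<subseteq> Q\<close>. Equality follows because both
  sides have the same order, the full power of \<open>p\<close> in the group order.
\<close>
lemma sylow_conjugate:
  assumes fin: "finite (carrier G)" and "prime p"
    and P: "P \<in> sylow_subgroups G p" and Q: "Q \<in> sylow_subgroups G p"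
  obtains a where "a \<in> carrier G" "Q = conjugate a ` P"
proof -
  let ?m = "multiplicity p (order G)"
  have sP: "subgroup P G" "card P = p ^ ?m" and sQ: "subgroup Q G" "card Q = p ^ ?m"
    using P Q by (auto simp: sylow_subgroups_def)
  let ?E = "rcosets Q" and ?\<phi> = "\<lambda>g. \<lambda>R\<in>rcosets Q. R #> inv g"
  have lag: "card ?E * p ^ ?m = order G"
    using lagrange[OF sQ(1)] sQ(2) by simp
  have "order G > 0"
    using fin order_gt_0_iff_finite by blast
  have ndvd: "\<not> p dvd card ?E"
  proof
    assume "p dvd card ?E"
    then have "p ^ Suc ?m dvd order G"
      using mult_dvd_mono[of p "card ?E" "p ^ ?m" "p ^ ?m"] lag by simp
    moreover have "\<not> is_unit p"
      using \<open>prime p\<close> by (auto dest: not_prime_unit)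
    ultimately show False
      using \<open>order G > 0\<close> power_dvd_iff_le_multiplicity[of "order G" p "Suc ?m"] by simp
  qed
  have finE: "finite ?E"
    using fin by (simp add: RCOSETS_def)
  have ord: "order (G\<lparr>carrier := P\<rparr>) = p ^ ?m"
    using sP by (simp add: order_def)
  have act: "group_action (G\<lparr>carrier := P\<rparr>) ?E ?\<phi>"
    using group_action.induced_action[OF coset_action[OF sQ(1)] sP(1)] .
  obtain R where R: "R \<in> ?E"
      and "\<And>g. g \<in> carrier (G\<lparr>carrier := P\<rparr>) \<Longrightarrow> ?\<phi> g R = R"
    by (rule group_action.prime_power_fixed_point[OF act \<open>prime p\<close> ord finE ndvd], rule that)
  then have fixed: "?\<phi> g R = R" if "g \<in> P" for g
    using that by simp
  obtain a where a: "a \<in> carrier G" "R = Q #> a"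
    using R unfolding RCOSETS_def by auto
  have "conjugate a g \<in> Q" if g: "g \<in> P" for g
  proof -
    have gc: "g \<in> carrier G" and ig: "inv g \<in> P"
      using g sP(1) by (auto simp: subgroup.mem_carrier subgroup.m_inv_closed)
    have "R #> g = R"
      using R fixed[OF ig] gc by simp
    then have "Q #> (a \<otimes> g) = Q #> a"
      using a gc coset_mult_assoc[OF subgroup.subset[OF sQ(1)]] by simp
    then have "a \<otimes> g \<in> Q #> a"
      using repr_independenceD[OF sQ(1), of "a \<otimes> g" a] a gc by simp
    then show ?thesis
      using subgroup.rcos_module_imp[OF sQ(1) is_group a(1)] by blast
  qed
  then have "conjugate a ` P \<subseteq> Q"
    by blast
  moreover have "card (conjugate a ` P) = card Q"
    using conjugate_image_sylow[OF a(1) P] sQ(2) by (simp add: sylow_subgroups_def)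
  moreover have "finite Q"
    using sylow_subgroup_subset[OF Q] fin finite_subset by blast
  ultimately have "conjugate a ` P = Q"
    using card_subset_eq by blast
  with a that show ?thesis by blast
qed

section \<open>Counting p-elements\<close>

lemma finite_sylow_subgroups:
  assumes "finite (carrier G)"
  shows "finite (sylow_subgroups G p)"
  by (rule finite_subset[of _ "Pow (carrier G)"]) (use assms sylow_subgroup_subset in auto)

lemma sylow_count_pos:
  assumes "finite (carrier G)" "Q \<in> sylow_subgroups G p" "x \<in> Q"
  shows "sylow_count G p x > 0"
  using assms finite_sylow_subgroups[OF assms(1)]
  by (auto simp: sylow_count_def card_gt_0_iff)

lemma sylow_count_conjugate:
  assumes a: "a \<in> carrier G" and x: "x \<in> carrier G"
  shows "sylow_count G p (conjugate a x) = sylow_count G p x"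
proof -
  have "bij_betw (image (conjugate a)) {Q \<in> sylow_subgroups G p. x \<in> Q}
          {Q \<in> sylow_subgroups G p. conjugate a x \<in> Q}"
  proof (rule bij_betw_byWitness[where f' = "image (conjugate (inv a))"])
    show "\<forall>Q\<in>{Q \<in> sylow_subgroups G p. x \<in> Q}. conjugate (inv a) ` conjugate a ` Q = Q"
      by (intro ballI conjugate_image_inv_image(2) a) (rule sylow_subgroup_subset[of _ p], simp)
    show "\<forall>Q\<in>{Q \<in> sylow_subgroups G p. conjugate a x \<in> Q}.
            conjugate a ` conjugate (inv a) ` Q = Q"
      by (intro ballI conjugate_image_inv_image(1) a) (rule sylow_subgroup_subset[of _ p], simp)
    show "image (conjugate a) ` {Q \<in> sylow_subgroups G p. x \<in> Q}
            \<subseteq> {Q \<in> sylow_subgroups G p. conjugate a x \<in> Q}"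
      using conjugate_image_sylow[OF a] by blast
    have "x \<in> conjugate (inv a) ` Q" if "conjugate a x \<in> Q" for Q
      using imageI[OF that, of "conjugate (inv a)"] conjugate_inv_conjugate(2)[OF a x] by simp
    then show "image (conjugate (inv a)) ` {Q \<in> sylow_subgroups G p. conjugate a x \<in> Q}
            \<subseteq> {Q \<in> sylow_subgroups G p. x \<in> Q}"
      using conjugate_image_sylow[OF inv_closed[OF a]] by blast
  qed
  then show ?thesis
    unfolding sylow_count_def by (rule bij_betw_same_card[symmetric])
qed

text \<open>
  Double counting of the pairs \<open>x \<in> Q\<close>, each weighted by \<open>1/\<lambda>(x)\<close>: the pairs with a given \<open>x\<close>
  have total weight \<open>1\<close>.
\<close>
lemma card_p_elements_eq_weights:
  assumes fin: "finite (carrier G)"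
  shows "real (card (p_elements G p))
           = (\<Sum>Q\<in>sylow_subgroups G p. \<Sum>x\<in>Q. 1 / real (sylow_count G p x))"
proof -
  let ?S = "sylow_subgroups G p" and ?U = "p_elements G p"
  have finU: "finite ?U"
    unfolding p_elements_def
    using finite_sylow_subgroups[OF fin] finite_subset[OF sylow_subgroup_subset fin]
    by (rule finite_UN_I)
  have "real (card ?U) = (\<Sum>x\<in>?U. \<Sum>Q | Q \<in> ?S \<and> x \<in> Q. 1 / real (sylow_count G p x))"
  proof -
    have "(\<Sum>Q | Q \<in> ?S \<and> x \<in> Q. 1 / real (sylow_count G p x)) = 1" if "x \<in> ?U" for x
    proof -
      have "sylow_count G p x > 0"
        using that sylow_count_pos[OF fin] unfolding p_elements_def by blast
      then show ?thesis
        by (simp add: sylow_count_def)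
    qed
    then show ?thesis
      unfolding card_eq_sum of_nat_sum of_nat_1 by (intro sum.cong refl) (rule sym)
  qed
  also have "\<dots> = (\<Sum>Q\<in>?S. \<Sum>x | x \<in> ?U \<and> x \<in> Q. 1 / real (sylow_count G p x))"
    using finU finite_sylow_subgroups[OF fin] by (rule sum.swap_restrict)
  also have "\<dots> = (\<Sum>Q\<in>?S. \<Sum>x\<in>Q. 1 / real (sylow_count G p x))"
    by (intro sum.cong refl) (auto simp: p_elements_def)
  finally show ?thesis .
qed

lemma card_p_elements_eq_num_sylow_mult:
  assumes fin: "finite (carrier G)" and "prime p" and P: "P \<in> sylow_subgroups G p"
  shows "real (card (p_elements G p))
           = real (num_sylow G p) * (\<Sum>x\<in>P. 1 / real (sylow_count G p x))"
proof -
  have "(\<Sum>x\<in>Q. 1 / real (sylow_count G p x)) = (\<Sum>x\<in>P. 1 / real (sylow_count G p x))"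
    if Q: "Q \<in> sylow_subgroups G p" for Q
  proof -
    obtain a where a: "a \<in> carrier G" "Q = conjugate a ` P"
      using sylow_conjugate[OF fin \<open>prime p\<close> P Q] .
    have "inj_on (conjugate a) P"
      using inj_on_subset[OF inj_on_conjugate[OF a(1)] sylow_subgroup_subset[OF P]] .
    then show ?thesis
      using a sylow_subgroup_subset[OF P]
      by (auto simp: sum.reindex sylow_count_conjugate intro!: sum.cong)
  qed
  then show ?thesis
    unfolding card_p_elements_eq_weights[OF fin] num_sylow_def by simp
qed

end

section \<open>The inequality\<close>

theorem mainTheorem3:
  fixes G :: "('a, 'b) monoid_scheme" and p :: nat and P :: "'a set"
  assumes "group G"
    and "finite (carrier G)"
    and "prime p"
    and "p dvd order G"
    and "P \<in> sylow_subgroups G p"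
    and "real (\<Prod>x\<in>P. sylow_count G p x) powr (1 / real (card P))
           \<le> real (num_sylow G p) powr (1 / real p)"
  shows "real (card (p_elements G p)) / real (card P)
           \<ge> real (num_sylow G p) powr (1 - 1 / real p)"
proof -
  interpret group G by fact
  let ?l = "sylow_count G p" and ?n = "real (num_sylow G p)" and ?k = "real (card P)"
  have finP: "finite P"
    using finite_subset[OF sylow_subgroup_subset[OF assms(5)] assms(2)] .
  have neP: "P \<noteq> {}"
    using assms(5) by (auto simp: sylow_subgroups_def dest: subgroup.one_closed)
  have lpos: "?l x > 0" if "x \<in> P" for x
    using sylow_count_pos[OF assms(2,5) that] .
  have prod_pos: "real (\<Prod>x\<in>P. ?l x) powr (1 / ?k) > 0"
    using lpos finP by simp
  have npos: "?n > 0"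
    using finite_sylow_subgroups[OF assms(2)] assms(5) by (auto simp: num_sylow_def card_gt_0_iff)
  have "?n powr (1 - 1 / real p) = ?n * (1 / ?n powr (1 / real p))"
    using npos by (simp add: powr_diff)
  also have "\<dots> \<le> ?n * (1 / real (\<Prod>x\<in>P. ?l x) powr (1 / ?k))"
    using assms(6) prod_pos npos by (intro mult_left_mono divide_left_mono) auto
  also have "1 / real (\<Prod>x\<in>P. ?l x) powr (1 / ?k) = (\<Prod>x\<in>P. 1 / real (?l x)) powr (1 / ?k)"
    by (simp add: prod_dividef powr_divide prod_nonneg)
  also have "?n * \<dots> \<le> ?n * (\<Sum>x\<in>P. 1 / real (?l x) / ?k)"
    by (intro mult_left_mono arith_geom_mean finP neP) auto
  also have "\<dots> = real (card (p_elements G p)) / ?k"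
    unfolding card_p_elements_eq_num_sylow_mult[OF assms(2,3,5)]
    by (simp only: sum_divide_distrib [symmetric] times_divide_eq_right)
  finally show ?thesis .
qed

end
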